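(* Let $d\ge1$, let $U$ be a subset of the depth-$d$ binary interval $B_d$, and let $H$ be an ordered-triangle-free graph on $U$. For every $\eta>0$, the number of levels $\ell\in\{1,\dots,d\}$ satisfying $$e_\ell(H)\ge\frac12\,UU_\ell+\eta\,\tau_{\ell,d}$$ is at most $\dfrac{1}{2\eta}$.
   Context: For $d\ge1$, the depth-$d$ binary interval is $B_d=\{0,1\}^d$ with lexicographic order. For $x<y$ in $B_d$ the level is $\delta(x,y)=\min\{i:x_i\ne y_i\}$. The number of pairs $x<y$ in $B_d$ with $\delta(x,y)=\ell$ is $\tau_{\ell,d}=2^{2d-\ell-1}$. For a graph $H$ on a subset of $B_d$, $e_\ell(H)$ is the number of edges $xy$ of $H$ ($x<y$) with $\delta(x,y)=\ell$. $UU_\ell$ is the number of pairs $x<y$ with $\delta(x,y)=\ell$ and $x,y\in U$. A graph is ordered-triangle-free if it has no $x<y<z$ with $xy,xz,yz$ all edges. *)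

theory Defs
  imports Complex_Main "HOL-Library.List_Lexorder"
begin

(* Letters: False is 0 and True is 1. The order < on lists is the lexicographic one of
   HOL-Library.List_Lexorder, induced by False < True. *)
definition binary_interval :: "nat \<Rightarrow> bool list set" where
  "binary_interval d = {x. length x = d}"

(* Coordinates are numbered from 1, so x_i is x ! (i - 1). Meaningful only for distinct lists
   of equal length. *)
definition level :: "bool list \<Rightarrow> bool list \<Rightarrow> nat" where
  "level x y = Min {i \<in> {1..length x}. x ! (i - 1) \<noteq> y ! (i - 1)}"

definition pairs_at_level :: "bool list set \<Rightarrow> nat \<Rightarrow> (bool list \<times> bool list) set" where
  "pairs_at_level U l = {(x, y). x \<in> U \<and> y \<in> U \<and> x < y \<and> level x y = l}"

definition UU :: "bool list set \<Rightarrow> nat \<Rightarrow> nat" where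
  "UU U l = card (pairs_at_level U l)"

definition tau :: "nat \<Rightarrow> nat \<Rightarrow> nat" where
  "tau l d = card (pairs_at_level (binary_interval d) l)"

definition simple_graph_on :: "'a set \<Rightarrow> 'a set set \<Rightarrow> bool" where
  "simple_graph_on V E \<longleftrightarrow> (\<forall>e\<in>E. \<exists>x\<in>V. \<exists>y\<in>V. x \<noteq> y \<and> e = {x, y})"

definition ordered_triangle_free :: "'a::order set set \<Rightarrow> bool" where
  "ordered_triangle_free E \<longleftrightarrow>
     \<not> (\<exists>x y z. x < y \<and> y < z \<and> {x, y} \<in> E \<and> {x, z} \<in> E \<and> {y, z} \<in> E)"

definition edges_at_level :: "bool list set set \<Rightarrow> nat \<Rightarrow> nat" where
  "edges_at_level E l = card {(x, y). x < y \<and> {x, y} \<in> E \<and> level x y = l}"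

lemma level_append:
  assumes "a \<noteq> b"
  shows "level (p @ a # u) (p @ b # v) = Suc (length p)"
  unfolding level_def
proof (rule Min_eqI)
  fix i
  assume i: "i \<in> {i \<in> {1..length (p @ a # u)}. (p @ a # u) ! (i - 1) \<noteq> (p @ b # v) ! (i - 1)}"
  show "Suc (length p) \<le> i"
  proof (rule ccontr)
    assume "\<not> Suc (length p) \<le> i"
    with i have "i - 1 < length p" by auto
    with i show False by (auto simp: nth_append)
  qed
qed (use assms in auto)

lemma less_binary_iff:
  assumes "length x = length y"
  shows "x < y \<longleftrightarrow> (\<exists>p u v. x = p @ False # u \<and> y = p @ True # v)"
proof
  assume "x < y"
  then show "\<exists>p u v. x = p @ False # u \<and> y = p @ True # v"
    using assms by (auto simp: list_less_def lexord_def less_bool_def)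
next
  assume "\<exists>p u v. x = p @ False # u \<and> y = p @ True # v"
  then obtain p u v where "x = p @ False # u" "y = p @ True # v" by blast
  then show "x < y"
    unfolding list_less_def lexord_def less_bool_def by blast
qed

lemma tau_eq:
  assumes "1 \<le> l" "l \<le> d"
  shows "tau l d = 2 ^ (2 * d - l - 1)"
proof -
  define L :: "nat \<Rightarrow> bool list set" where "L n = {x. length x = n}" for n
  have cardL: "card (L n) = 2 ^ n" for n
    using card_lists_length_eq[of "UNIV :: bool set" n] by (simp add: L_def card_UNIV_bool)
  define f where "f = (\<lambda>(p, u, v). (p @ False # u, p @ True # v))"
  have "pairs_at_level (binary_interval d) l = f ` (L (l - 1) \<times> L (d - l) \<times> L (d - l))"
    (is "?A = ?B")
  proof (intro equalityI subsetI)
    fix z assume "z \<in> ?A"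
    then obtain x y where z: "z = (x, y)" and len: "length x = d" "length y = d"
      and "x < y" "level x y = l"
      by (auto simp: pairs_at_level_def binary_interval_def)
    then obtain p u v where xy: "x = p @ False # u" "y = p @ True # v"
      using less_binary_iff[of x y] by auto
    with \<open>level x y = l\<close> have "l = Suc (length p)" by (simp add: level_append)
    with z len xy show "z \<in> ?B"
      by (auto simp: f_def L_def intro!: image_eqI[where x = "(p, u, v)"])
  next
    fix z assume "z \<in> ?B"
    then obtain p u v where "z = (p @ False # u, p @ True # v)"
      "length p = l - 1" "length u = d - l" "length v = d - l"
      by (auto simp: f_def L_def)
    with assms show "z \<in> ?A"
      using less_binary_iff[of "p @ False # u" "p @ True # v"]
      by (auto simp: pairs_at_level_def binary_interval_def level_append)
  qed
  moreover have "inj_on f (L (l - 1) \<times> L (d - l) \<times> L (d - l))"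
    by (auto simp: inj_on_def f_def L_def)
  ultimately have "tau l d = 2 ^ (l - 1) * (2 ^ (d - l) * 2 ^ (d - l))"
    by (simp add: tau_def card_image card_cartesian_product cardL)
  also have "\<dots> = 2 ^ ((l - 1) + ((d - l) + (d - l)))"
    by (simp only: power_add)
  also have "(l - 1) + ((d - l) + (d - l)) = 2 * d - l - 1"
    using assms by auto
  finally show ?thesis .
qed

end

theory Submission
  imports Defs
begin

text \<open>
  Write \<open>\<delta>\<^sub>l = (e\<^sub>l(H) - UU\<^sub>l / 2) / \<tau>\<^sub>l\<close> for the excess density at level \<open>l\<close>. If \<open>k\<close> levels satisfy
  \<open>\<delta>\<^sub>l \<ge> \<eta>\<close>, the bound \<open>k \<le> 1 / (2 \<eta>)\<close> follows once \<open>\<Sum>l\<in>S. \<delta>\<^sub>l \<le> 1/2\<close> is known for every set \<open>S\<close>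
  of levels.

  Mantel's theorem alone, applied to the whole interval, only bounds a sum of the \<open>\<delta>\<^sub>l\<close> in which
  each level has a weight twice that of the next. Two ideas repair this.

  \<^item> Restriction to a set of levels. Regard \<open>B\<^sub>d\<close> as the leaves of a binary tree. Choose a random
    subtree that keeps both children of a node at the levels in \<open>S\<close> and one child, independently
    and uniformly for each node, at all other levels. Its leaf set \<open>X\<close> has
    \<open>2\<close> to the power \<open>card S\<close> elements, and a pair of leaves of \<open>X\<close> that separates at level
    \<open>l \<in> S\<close> is distributed like a uniform pair of \<open>B\<^sub>d\<close> at level \<open>l\<close>
    (\<open>subtree_mean_pair_sum\<close>). Mantel's theorem holds in each \<open>X\<close>; in the form
    \<open>triangle_free_excess\<close> it leaves an error linear in \<open>card X\<close>, which comes from the missing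
    diagonal. Averaging over \<open>X\<close> gives \<open>\<Sum>l\<in>S. 2\<^bsup>r(l)\<^esup> \<delta>\<^sub>l \<le> 1\<close>, where \<open>r(l)\<close> is the rank of \<open>l\<close>
    in \<open>S\<close> counted from the deepest level (\<open>weighted_excess_le_one\<close>).

  \<^item> Removing the weights. The weighted inequality also holds for the \<open>j\<close> deepest levels of \<open>S\<close>,
    with the same weights, for each \<open>j\<close>. The nonnegative combination of these inequalities
    that makes all weights equal to \<open>1\<close> has right-hand side
    \<open>1/4 + 1/8 + \<dots>\<close> up to the last term, which is doubled; so it is exactly \<open>1/2\<close>
    (\<open>sum_le_half_of_weighted\<close>).

  Below, levels are replaced by heights \<open>h = d - l\<close>: passing to a subtree changes the level of a
  node, but not its height.
\<close>

section \<open>Mantel's inequality\<close>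

text \<open>
  The two ends of an edge have no common neighbour, so their degrees add up to at most
  \<open>card V\<close>. Summed over edges this bounds the sum of the squared degrees from above; expanding
  the squared deviations of the degrees from \<open>n / 2\<close> bounds it from below. Both sides count ordered pairs, and the
  hypothesis excludes loops as well, since \<open>x\<close>, \<open>y\<close> and \<open>z\<close> may coincide.
\<close>

lemma mantel:
  fixes E :: "'a set set"
  assumes fin: "finite V"
    and tf: "\<And>x y z. \<lbrakk>x \<in> V; y \<in> V; z \<in> V; {x, y} \<in> E; {x, z} \<in> E; {y, z} \<in> E\<rbrakk> \<Longrightarrow> False"
  shows "2 * (\<Sum>x\<in>V. \<Sum>y\<in>V. of_bool ({x, y} \<in> E)) \<le> (real (card V))\<^sup>2"
proof (cases "V = {}")
  case False
  define n where "n = real (card V)"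
  define a where "a x y = (of_bool ({x, y} \<in> E) :: real)" for x y
  define deg where "deg x = (\<Sum>y\<in>V. a x y)" for x
  have n: "n > 0"
    using False fin by (simp add: n_def card_gt_0_iff)
  have sym: "a x y = a y x" for x y
    by (simp add: a_def insert_commute)
  have edge: "a x y * (deg x + deg y) \<le> a x y * n" if "x \<in> V" "y \<in> V" for x y
  proof (cases "{x, y} \<in> E")
    case True
    have "deg x + deg y = (\<Sum>z\<in>V. a x z + a y z)"
      by (simp add: deg_def sum.distrib)
    also have "\<dots> \<le> (\<Sum>z\<in>V. 1)"
      using tf[OF that] True by (intro sum_mono) (auto simp: a_def)
    finally show ?thesis
      by (simp add: True a_def n_def)
  qed (simp add: a_def)
  have swap: "(\<Sum>x\<in>V. \<Sum>y\<in>V. a x y * deg y) = (\<Sum>x\<in>V. \<Sum>y\<in>V. a x y * deg x)"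
    by (subst sum.swap) (simp add: sym)
  have "2 * (\<Sum>x\<in>V. (deg x)\<^sup>2) = (\<Sum>x\<in>V. \<Sum>y\<in>V. a x y * (deg x + deg y))"
    by (simp add: distrib_left sum.distrib swap)
       (simp add: deg_def power2_eq_square flip: sum_distrib_right)
  also have "\<dots> \<le> (\<Sum>x\<in>V. \<Sum>y\<in>V. a x y * n)"
    by (intro sum_mono edge)
  also have "\<dots> = n * (\<Sum>x\<in>V. deg x)"
    by (simp add: deg_def mult.commute sum_distrib_left)
  finally have upper: "2 * (\<Sum>x\<in>V. (deg x)\<^sup>2) \<le> n * (\<Sum>x\<in>V. deg x)" .
  have "0 \<le> (\<Sum>x\<in>V. (2 * deg x - n)\<^sup>2)"
    by (simp add: sum_nonneg)
  also have "\<dots> = 4 * (\<Sum>x\<in>V. (deg x)\<^sup>2) - 4 * n * (\<Sum>x\<in>V. deg x) + n * n\<^sup>2"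
    by (simp add: power2_diff sum.distrib sum_subtractf sum_distrib_left sum_distrib_right n_def
        power_mult_distrib algebra_simps)
  finally have "n * (2 * (\<Sum>x\<in>V. deg x)) \<le> n * n\<^sup>2"
    using upper by (simp add: algebra_simps)
  with n have "2 * (\<Sum>x\<in>V. deg x) \<le> n\<^sup>2"
    by (simp only: mult_le_cancel_left_pos)
  then show ?thesis
    by (simp add: deg_def a_def n_def)
qed simp

lemma edge_endpoints:
  assumes "simple_graph_on U H" "{x, y} \<in> H"
  shows "x \<in> U \<and> y \<in> U \<and> x \<noteq> y"
  using assms by (fastforce simp: simple_graph_on_def doubleton_eq_iff)

text \<open>
  With \<open>n = card (X \<inter> U)\<close>, Mantel's bound \<open>n\<^sup>2 / 2\<close> on ordered edges exceeds half the number
  \<open>n (n - 1)\<close> of ordered pairs by \<open>n / 2\<close>. Since the bound is linear in \<open>card X\<close>, while the pairs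
  are quadratic in number, large sets \<open>X\<close> give small excess densities.
\<close>

lemma triangle_free_excess:
  fixes H :: "bool list set set"
  assumes fin: "finite X"
    and graph: "simple_graph_on U H"
    and tf: "ordered_triangle_free H"
  shows "(\<Sum>x\<in>X. \<Sum>y\<in>X. of_bool ({x, y} \<in> H) - 1/2 * of_bool (x \<in> U \<and> y \<in> U \<and> x \<noteq> y))
         \<le> real (card X) / 2"
proof -
  define V where "V = X \<inter> U"
  have finV: "finite V" and VX: "V \<subseteq> X"
    using fin by (auto simp: V_def)
  note HU = edge_endpoints[OF graph]
  have no_triangle: False if "{x, y} \<in> H" "{x, z} \<in> H" "{y, z} \<in> H" for x y z
  proof -
    have neq: "x \<noteq> y" "x \<noteq> z" "y \<noteq> z"
      using that HU by blast+
    have ord: False if "u < v" "v < w" "{u, v} \<in> H" "{u, w} \<in> H" "{v, w} \<in> H" for u v w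
      using tf that unfolding ordered_triangle_free_def by blast
    show False
      using neq that ord[of x y z] ord[of x z y] ord[of y x z] ord[of y z x] ord[of z x y]
        ord[of z y x] by (auto simp: neq_iff insert_commute)
  qed
  have "(\<Sum>x\<in>X. \<Sum>y\<in>X. of_bool ({x, y} \<in> H) - 1/2 * of_bool (x \<in> U \<and> y \<in> U \<and> x \<noteq> y))
      = (\<Sum>x\<in>V. \<Sum>y\<in>V. of_bool ({x, y} \<in> H) - 1/2 * (1 - of_bool (x = y)) :: real)"
  proof (rule sum.mono_neutral_cong_right[OF fin VX])
    show "\<forall>x\<in>X - V. (\<Sum>y\<in>X. of_bool ({x, y} \<in> H)
        - 1/2 * of_bool (x \<in> U \<and> y \<in> U \<and> x \<noteq> y)) = (0::real)"
      using HU by (auto simp: V_def intro!: sum.neutral)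
    show "(\<Sum>y\<in>X. of_bool ({x, y} \<in> H) - 1/2 * of_bool (x \<in> U \<and> y \<in> U \<and> x \<noteq> y))
        = (\<Sum>y\<in>V. of_bool ({x, y} \<in> H) - 1/2 * (1 - of_bool (x = y)) :: real)"
      if "x \<in> V" for x
      using that HU by (intro sum.mono_neutral_cong_right[OF fin VX]) (auto simp: V_def)
  qed
  also have "\<dots> = (\<Sum>x\<in>V. \<Sum>y\<in>V. of_bool ({x, y} \<in> H))
      - 1/2 * ((real (card V))\<^sup>2 - real (card V))"
    using finV by (simp add: sum_subtractf of_bool_def power2_eq_square flip: sum_divide_distrib)
      (simp add: field_simps)
  also have "\<dots> \<le> real (card V) / 2"
  proof -
    have "2 * (\<Sum>x\<in>V. \<Sum>y\<in>V. of_bool ({x, y} \<in> H)) \<le> (real (card V))\<^sup>2"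
      using finV no_triangle by (rule mantel)
    then show ?thesis
      by (simp add: field_simps)
  qed
  also have "\<dots> \<le> real (card X) / 2"
    by (simp add: card_mono fin VX)
  finally show ?thesis .
qed

section \<open>Random strong subtrees\<close>

text \<open>
  The expectation of \<open>f X\<close>, where \<open>X\<close> is the leaf set of a random subtree of the binary tree of
  depth \<open>d\<close>: nodes at a height in \<open>T\<close> keep both children, with independent random subtrees below
  them, and other nodes keep one child, chosen by a fair coin. The recursion evaluates the
  expectation directly, without a probability space. The root of the tree of depth \<open>Suc d\<close> has
  height \<open>d\<close>, so that \<open>T\<close> stays fixed in the recursion.
\<close>

fun subtree_mean :: "nat set \<Rightarrow> nat \<Rightarrow> (bool list set \<Rightarrow> real) \<Rightarrow> real" where
  "subtree_mean T 0 f = f {[]}"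
| "subtree_mean T (Suc d) f =
     (if d \<in> T
      then subtree_mean T d (\<lambda>A. subtree_mean T d (\<lambda>B. f ((#) False ` A \<union> (#) True ` B)))
      else (subtree_mean T d (\<lambda>A. f ((#) False ` A)) + subtree_mean T d (\<lambda>A. f ((#) True ` A))) / 2)"

definition branchings_below :: "nat set \<Rightarrow> nat \<Rightarrow> nat" where
  "branchings_below T h = card (T \<inter> {..<h})"

lemma branchings_below_0 [simp]: "branchings_below T 0 = 0"
  by (simp add: branchings_below_def)

lemma branchings_below_Suc [simp]:
  "branchings_below T (Suc h) = branchings_below T h + (if h \<in> T then 1 else 0)"
  by (simp add: branchings_below_def lessThan_Suc Int_insert_right)

lemma finite_binary_interval [simp]: "finite (binary_interval d)"
  using finite_lists_length_eq[of "UNIV :: bool set" d] by (simp add: binary_interval_def)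

lemma binary_interval_0 [simp]: "binary_interval 0 = {[]}"
  by (auto simp: binary_interval_def)

lemma binary_interval_Suc:
  "binary_interval (Suc d) = (#) False ` binary_interval d \<union> (#) True ` binary_interval d"
  by (auto simp: binary_interval_def length_Suc_conv image_iff)

lemma sum_halves:
  fixes f :: "bool list \<Rightarrow> 'b::comm_monoid_add"
  assumes "finite A" "finite B"
  shows "(\<Sum>x\<in>(#) False ` A \<union> (#) True ` B. f x) = (\<Sum>x\<in>A. f (False # x)) + (\<Sum>x\<in>B. f (True # x))"
  using assms by (subst sum.union_disjoint) (auto simp: sum.reindex inj_on_def)

lemma card_halves:
  assumes "finite A" "finite B"
  shows "card ((#) False ` A \<union> (#) True ` B) = card A + card B"
  using sum_halves[OF assms, of "\<lambda>_. 1::nat"] by simp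

lemma subtree_mean_mono:
  assumes "\<And>X. X \<subseteq> binary_interval d \<Longrightarrow> card X = 2 ^ branchings_below T d \<Longrightarrow> f X \<le> g X"
  shows "subtree_mean T d f \<le> subtree_mean T d g"
  using assms
proof (induction d arbitrary: f g)
  case (Suc d)
  have fin: "finite A" if "A \<subseteq> binary_interval d" for A
    using that finite_binary_interval by (rule finite_subset)
  show ?case
  proof (cases "d \<in> T")
    case True
    show ?thesis
      unfolding subtree_mean.simps if_P[OF True]
      by (intro Suc.IH Suc.prems) (use True fin in \<open>auto simp: binary_interval_Suc card_halves\<close>)
  next
    case False
    have "subtree_mean T d (\<lambda>A. f ((#) b ` A)) \<le> subtree_mean T d (\<lambda>A. g ((#) b ` A))" for b
      by (intro Suc.IH Suc.prems)
         (use False in \<open>cases b; auto simp: binary_interval_Suc card_image inj_on_def\<close>)+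
    from add_mono[OF this[of False] this[of True]] False show ?thesis
      by simp
  qed
qed simp

lemma subtree_mean_cong:
  assumes "\<And>X. X \<subseteq> binary_interval d \<Longrightarrow> f X = g X"
  shows "subtree_mean T d f = subtree_mean T d g"
  by (intro antisym subtree_mean_mono) (simp_all add: assms)

lemma subtree_mean_const [simp]: "subtree_mean T d (\<lambda>_. c) = c"
  by (induction d) auto

lemma subtree_mean_add:
  "subtree_mean T d (\<lambda>X. f X + g X) = subtree_mean T d f + subtree_mean T d g"
  by (induction d arbitrary: f g) (simp_all add: add_divide_distrib)

lemma subtree_mean_cmult: "subtree_mean T d (\<lambda>X. c * f X) = c * subtree_mean T d f"
  by (induction d arbitrary: f) (simp_all add: algebra_simps)

text \<open>
  Every subtree has the same number of leaves, and by symmetry a leaf chosen uniformly from the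
  random subtree is uniform in \<open>binary_interval d\<close>; the coefficient is the ratio of the leaf numbers.
\<close>

lemma subtree_mean_sum:
  "subtree_mean T d (\<lambda>X. \<Sum>x\<in>X. g x)
   = 2 ^ branchings_below T d / 2 ^ d * (\<Sum>x\<in>binary_interval d. g x)"
proof (induction d arbitrary: g)
  case (Suc d)
  have fin: "finite A" if "A \<subseteq> binary_interval d" for A
    using that finite_binary_interval by (rule finite_subset)
  have half: "subtree_mean T d (\<lambda>A. \<Sum>x\<in>(#) b ` A. g x)
      = 2 ^ branchings_below T d / 2 ^ d * (\<Sum>x\<in>binary_interval d. g (b # x))" for b
    using Suc.IH[of "\<lambda>x. g (b # x)"] by (simp add: sum.reindex)
  have both: "subtree_mean T d (\<lambda>A. subtree_mean T d (\<lambda>B. \<Sum>x\<in>(#) False ` A \<union> (#) True ` B. g x))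
      = subtree_mean T d (\<lambda>A. subtree_mean T d (\<lambda>B.
          (\<Sum>x\<in>A. g (False # x)) + (\<Sum>x\<in>B. g (True # x))))"
    by (intro subtree_mean_cong sum_halves fin)
  show ?case
    by (simp add: half both subtree_mean_add Suc.IH binary_interval_Suc sum_halves)
       (simp add: field_simps)
qed simp

lemma level_Cons_neq: "a \<noteq> b \<Longrightarrow> level (a # x) (b # y) = 1"
  using level_append[of a b "[]"] by simp

lemma level_Cons_same:
  assumes "x \<in> binary_interval d" "y \<in> binary_interval d" "x < y"
  shows "level (b # x) (b # y) = Suc (level x y)"
proof -
  obtain p u v where "x = p @ False # u" "y = p @ True # v"
    using assms less_binary_iff[of x y] by (auto simp: binary_interval_def)
  then show ?thesis
    using level_append[of False True p u v] level_append[of False True "b # p" u v] by simp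
qed

lemma level_pos:
  assumes "x \<in> binary_interval d" "y \<in> binary_interval d" "x < y"
  shows "level x y > 0"
proof -
  obtain p u v where "x = p @ False # u" "y = p @ True # v"
    using assms less_binary_iff[of x y] by (auto simp: binary_interval_def)
  then show ?thesis
    using level_append[of False True p u v] by simp
qed

lemma finite_pairs_at_level [simp]: "finite (pairs_at_level (binary_interval d) l)"
  by (rule finite_subset[of _ "binary_interval d \<times> binary_interval d"])
     (auto simp: pairs_at_level_def)

lemma sum_pairs_top:
  fixes g :: "bool list \<Rightarrow> bool list \<Rightarrow> 'b::comm_monoid_add"
  shows
  "(\<Sum>(x, y)\<in>pairs_at_level (binary_interval (Suc d)) 1. g x y)
   = (\<Sum>x\<in>binary_interval d. \<Sum>y\<in>binary_interval d. g (False # x) (True # y))"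
proof -
  have "pairs_at_level (binary_interval (Suc d)) 1
      = map_prod ((#) False) ((#) True) ` (binary_interval d \<times> binary_interval d)"
    using level_pos[of _ d]
    by (fastforce simp: pairs_at_level_def binary_interval_Suc level_Cons_neq
        level_Cons_same[of _ d] less_bool_def)
  then show ?thesis
    by (simp add: sum.reindex inj_on_def sum.cartesian_product split_def)
qed

lemma sum_pairs_below:
  fixes g :: "bool list \<Rightarrow> bool list \<Rightarrow> 'b::comm_monoid_add"
  assumes "l > 0"
  shows "(\<Sum>(x, y)\<in>pairs_at_level (binary_interval (Suc d)) (Suc l). g x y)
   = (\<Sum>(x, y)\<in>pairs_at_level (binary_interval d) l. g (False # x) (False # y))
   + (\<Sum>(x, y)\<in>pairs_at_level (binary_interval d) l. g (True # x) (True # y))"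
proof -
  let ?P = "pairs_at_level (binary_interval d) l"
  have "pairs_at_level (binary_interval (Suc d)) (Suc l)
      = map_prod ((#) False) ((#) False) ` ?P \<union> map_prod ((#) True) ((#) True) ` ?P"
    using assms
    by (force simp: pairs_at_level_def binary_interval_Suc level_Cons_neq
        level_Cons_same[of _ d] less_bool_def)
  moreover have "inj_on (map_prod ((#) b) ((#) b)) ?P" for b
    by (auto simp: inj_on_def)
  ultimately show ?thesis
    by (simp only:) (subst sum.union_disjoint; auto simp: sum.reindex split_def)
qed

text \<open>
  Below a branching node the two subtrees are independent, and by \<open>subtree_mean_sum\<close> their leaves
  are uniform; so a pair of \<open>X\<close> that separates at height \<open>h \<in> T\<close> is a uniform pair at that height.
  With \<open>t\<close> branching heights in total and \<open>s\<close> of them below \<open>h\<close>, there are \<open>2\<^bsup>t + s - 1\<^esup>\<close> such pairs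
  in \<open>X\<close> and \<open>2\<^bsup>d + h - 1\<^esup>\<close> in the whole interval; the quotient is the coefficient. The factor \<open>2\<close>
  accounts for the two orders of a pair.
\<close>

lemma subtree_mean_pair_sum:
  fixes g :: "bool list \<Rightarrow> bool list \<Rightarrow> real"
  assumes sym: "\<And>x y. g x y = g y x" and irrefl: "\<And>x. g x x = 0"
  shows "subtree_mean T d (\<lambda>X. \<Sum>x\<in>X. \<Sum>y\<in>X. g x y)
    = 2 * (\<Sum>h\<in>T \<inter> {..<d}. 2 ^ (branchings_below T d + branchings_below T h) / 2 ^ (d + h)
        * (\<Sum>(x, y)\<in>pairs_at_level (binary_interval d) (d - h). g x y))"
  using assms
proof (induction d arbitrary: g)
  case (Suc d)
  let ?c = "2 ^ branchings_below T d / 2 ^ d :: real"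
  let ?w = "\<lambda>h. 2 ^ (branchings_below T d + branchings_below T h) / 2 ^ (d + h) :: real"
  let ?P = "\<lambda>h. pairs_at_level (binary_interval d) (d - h)"
  let ?Q = "\<lambda>h. pairs_at_level (binary_interval (Suc d)) (Suc d - h)"
  have fin: "finite A" if "A \<subseteq> binary_interval d" for A
    using that finite_binary_interval by (rule finite_subset)
  have half: "subtree_mean T d (\<lambda>A. \<Sum>x\<in>A. \<Sum>y\<in>A. g (b # x) (b # y))
      = 2 * (\<Sum>h\<in>T \<inter> {..<d}. ?w h * (\<Sum>(x, y)\<in>?P h. g (b # x) (b # y)))" for b
    by (rule Suc.IH) (use Suc.prems in auto)
  have halves: "subtree_mean T d (\<lambda>A. \<Sum>x\<in>A. \<Sum>y\<in>A. g (False # x) (False # y))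
      + subtree_mean T d (\<lambda>A. \<Sum>x\<in>A. \<Sum>y\<in>A. g (True # x) (True # y))
      = 2 * (\<Sum>h\<in>T \<inter> {..<d}. ?w h * (\<Sum>(x, y)\<in>?Q h. g x y))"
  proof -
    have "(\<Sum>h\<in>T \<inter> {..<d}. ?w h * (\<Sum>(x, y)\<in>?Q h. g x y))
        = (\<Sum>h\<in>T \<inter> {..<d}. ?w h * ((\<Sum>(x, y)\<in>?P h. g (False # x) (False # y))
            + (\<Sum>(x, y)\<in>?P h. g (True # x) (True # y))))"
      by (intro sum.cong) (auto simp: Suc_diff_le sum_pairs_below)
    then show ?thesis
      unfolding half by (simp only: distrib_left sum.distrib)
  qed
  show ?case
  proof (cases "d \<in> T")
    case True
    \<comment> \<open>The pairs split by the root: independence of the two halves turns the mean of the double sum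
      into a product of two applications of \<open>subtree_mean_sum\<close>.\<close>
    have cross: "subtree_mean T d (\<lambda>A. subtree_mean T d (\<lambda>B.
        \<Sum>x\<in>A. \<Sum>y\<in>B. g (False # x) (True # y)))
        = ?c\<^sup>2 * (\<Sum>(x, y)\<in>?Q d. g x y)"
    proof -
      have "subtree_mean T d (\<lambda>A. subtree_mean T d (\<lambda>B.
          \<Sum>x\<in>A. \<Sum>y\<in>B. g (False # x) (True # y)))
        = subtree_mean T d (\<lambda>A. ?c * (\<Sum>x\<in>A. \<Sum>y\<in>binary_interval d. g (False # x) (True # y)))"
        by (subst sum.swap, subst subtree_mean_sum, subst sum.swap) (rule refl)
      also have "\<dots> = ?c * (?c * (\<Sum>x\<in>binary_interval d. \<Sum>y\<in>binary_interval d.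
          g (False # x) (True # y)))"
        by (simp only: subtree_mean_cmult subtree_mean_sum)
      finally show ?thesis
        using sum_pairs_top[of g d] by (simp add: power2_eq_square)
    qed
    have "subtree_mean T (Suc d) (\<lambda>X. \<Sum>x\<in>X. \<Sum>y\<in>X. g x y)
        = subtree_mean T d (\<lambda>A. subtree_mean T d (\<lambda>B.
            (\<Sum>x\<in>A. \<Sum>y\<in>A. g (False # x) (False # y)) + (\<Sum>x\<in>B. \<Sum>y\<in>B. g (True # x) (True # y))
            + 2 * (\<Sum>x\<in>A. \<Sum>y\<in>B. g (False # x) (True # y))))"
      unfolding subtree_mean.simps if_P[OF True]
    proof (intro subtree_mean_cong)
      fix A B assume "A \<subseteq> binary_interval d" "B \<subseteq> binary_interval d"
      then have "finite A" "finite B"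
        by (auto intro: fin)
      moreover have "(\<Sum>x\<in>B. \<Sum>y\<in>A. g (True # x) (False # y))
          = (\<Sum>x\<in>A. \<Sum>y\<in>B. g (False # x) (True # y))"
        by (subst sum.swap) (simp add: Suc.prems(1)[of "True # _"])
      ultimately show "(\<Sum>x\<in>(#) False ` A \<union> (#) True ` B. \<Sum>y\<in>(#) False ` A \<union> (#) True ` B. g x y)
          = (\<Sum>x\<in>A. \<Sum>y\<in>A. g (False # x) (False # y)) + (\<Sum>x\<in>B. \<Sum>y\<in>B. g (True # x) (True # y))
            + 2 * (\<Sum>x\<in>A. \<Sum>y\<in>B. g (False # x) (True # y))"
        by (simp add: sum_halves sum.distrib)
    qed
    also have "\<dots> = 2 * (?c\<^sup>2 * (\<Sum>(x, y)\<in>?Q d. g x y)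
        + (\<Sum>h\<in>T \<inter> {..<d}. ?w h * (\<Sum>(x, y)\<in>?Q h. g x y)))"
      using halves by (simp add: subtree_mean_add subtree_mean_cmult cross)
    also have "?c\<^sup>2 = 2 ^ (branchings_below T (Suc d) + branchings_below T d) / 2 ^ (Suc d + d)"
      using True by (simp add: power2_eq_square power_add)
    also have "(\<Sum>h\<in>T \<inter> {..<d}. ?w h * (\<Sum>(x, y)\<in>?Q h. g x y))
        = (\<Sum>h\<in>T \<inter> {..<d}. 2 ^ (branchings_below T (Suc d) + branchings_below T h) / 2 ^ (Suc d + h)
            * (\<Sum>(x, y)\<in>?Q h. g x y))"
      using True by simp
    finally show ?thesis
      using True by (simp only: lessThan_Suc Int_insert_right if_True) simp
  next
    case False
    have "subtree_mean T (Suc d) (\<lambda>X. \<Sum>x\<in>X. \<Sum>y\<in>X. g x y)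
        = (\<Sum>h\<in>T \<inter> {..<d}. ?w h * (\<Sum>(x, y)\<in>?Q h. g x y))"
      using halves False by (simp add: sum.reindex)
    with False show ?thesis
      by (simp add: lessThan_Suc Int_insert_right sum_distrib_left)
  qed
qed simp

section \<open>Summing over levels\<close>

text \<open>
  The average of \<open>triangle_free_excess\<close> over random subtrees that branch at the heights in \<open>T\<close>.
  All of them have the same number \<open>2\<^sup>t\<close> of leaves, and \<open>2\<^sup>t\<close> is a factor both of the coefficients
  in \<open>subtree_mean_pair_sum\<close> and of the error term. After division by it the weight of height \<open>h\<close>
  depends only on the part of \<open>T\<close> below \<open>h\<close>.
\<close>

lemma weighted_excess_le_one:
  fixes T :: "nat set"
  assumes U: "U \<subseteq> binary_interval d"
    and graph: "simple_graph_on U H"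
    and tf: "ordered_triangle_free H"
    and T: "T \<subseteq> {..<d}"
  shows "(\<Sum>h\<in>T. 2 ^ Suc (branchings_below T h)
           * ((real (edges_at_level H (d - h)) - 1/2 * real (UU U (d - h))) / real (tau (d - h) d))) \<le> 1"
proof -
  define g :: "bool list \<Rightarrow> bool list \<Rightarrow> real" where
    "g x y = of_bool ({x, y} \<in> H) - 1/2 * of_bool (x \<in> U \<and> y \<in> U \<and> x \<noteq> y)" for x y
  let ?b = "branchings_below T"
  let ?P = "\<lambda>h. pairs_at_level (binary_interval d) (d - h)"
  let ?ex = "\<lambda>h. real (edges_at_level H (d - h)) - 1/2 * real (UU U (d - h))"
  note HU = edge_endpoints[OF graph]
  have sum_g: "(\<Sum>(x, y)\<in>?P h. g x y) = ?ex h" for h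
  proof -
    have "?P h \<inter> {(x, y). {x, y} \<in> H} = {(x, y). x < y \<and> {x, y} \<in> H \<and> level x y = d - h}"
      using HU U by (auto simp: pairs_at_level_def)
    moreover have "?P h \<inter> {(x, y). x \<in> U \<and> y \<in> U \<and> x \<noteq> y} = pairs_at_level U (d - h)"
      using U by (auto simp: pairs_at_level_def)
    ultimately show ?thesis
      by (simp add: g_def split_def sum_subtractf edges_at_level_def UU_def
          flip: sum_divide_distrib)
  qed
  have weight: "2 * (2 ^ (?b d + ?b h) / 2 ^ (d + h) * ?ex h)
      = 2 ^ ?b d / 2 * (2 ^ Suc (?b h) * (?ex h / real (tau (d - h) d)))" if "h \<in> T" for h
  proof -
    have h: "h < d" "2 * d - (d - h) - 1 = d + h - 1"
      using T that by auto
    then have "2 * real (tau (d - h) d) = 2 ^ (d + h)"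
      by (simp add: tau_eq flip: power_Suc)
    then have tau: "real (tau (d - h) d) = 2 ^ (d + h) / 2"
      by simp
    show ?thesis
      unfolding tau by (simp add: power_add)
  qed
  have "2 ^ ?b d / 2 * (\<Sum>h\<in>T. 2 ^ Suc (?b h) * (?ex h / real (tau (d - h) d)))
      = 2 * (\<Sum>h\<in>T. 2 ^ (?b d + ?b h) / 2 ^ (d + h) * ?ex h)"
    unfolding sum_distrib_left by (intro sum.cong refl weight[symmetric])
  also have "\<dots> = subtree_mean T d (\<lambda>X. \<Sum>x\<in>X. \<Sum>y\<in>X. g x y)"
  proof -
    have "{x} \<notin> H" for x
      using HU[of x x] by auto
    then show ?thesis
      using T by (subst subtree_mean_pair_sum) (auto simp: g_def insert_commute sum_g Int_absorb2)
  qed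
  also have "\<dots> \<le> subtree_mean T d (\<lambda>_. 2 ^ ?b d / 2)"
  proof (rule subtree_mean_mono)
    fix X assume X: "X \<subseteq> binary_interval d" "card X = 2 ^ ?b d"
    then have "finite X"
      using finite_subset[OF _ finite_binary_interval] by blast
    from triangle_free_excess[OF this graph tf] X show "(\<Sum>x\<in>X. \<Sum>y\<in>X. g x y) \<le> 2 ^ ?b d / 2"
      by (simp add: g_def)
  qed
  finally show ?thesis
    by simp
qed

text \<open>
  Summation by parts: \<open>\<delta> h\<close> is the increment of the weighted partial sum \<open>A\<close> at \<open>h\<close> divided by its
  weight, and these weights double from one element of \<open>T\<close> to the next. The extra term in the
  invariant of the induction on \<open>k\<close> records how far \<open>A k\<close> is below its bound \<open>1\<close>, divided by
  the weight that comes next.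
\<close>

lemma sum_le_half_of_weighted:
  fixes \<delta> :: "nat \<Rightarrow> real"
  assumes "finite T"
    and "\<And>k. (\<Sum>h\<in>T \<inter> {..<k}. 2 ^ Suc (branchings_below T h) * \<delta> h) \<le> 1"
  shows "(\<Sum>h\<in>T. \<delta> h) \<le> 1 / 2"
proof -
  define A where "A k = (\<Sum>h\<in>T \<inter> {..<k}. 2 ^ Suc (branchings_below T h) * \<delta> h)" for k
  have A_le: "A k \<le> 1" for k
    using assms(2) by (simp add: A_def)
  have partial: "(\<Sum>h\<in>T \<inter> {..<k}. \<delta> h) \<le> 1/2 - (1 - A k) / 2 ^ Suc (branchings_below T k)" for k
  proof (induction k)
    case (Suc k)
    show ?case
    proof (cases "k \<in> T")
      case True
      let ?p = "2 ^ Suc (branchings_below T k) :: real"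
      have "(\<Sum>h\<in>T \<inter> {..<Suc k}. \<delta> h) = (\<Sum>h\<in>T \<inter> {..<k}. \<delta> h) + \<delta> k"
        using True by (simp add: lessThan_Suc Int_insert_right)
      moreover have "A (Suc k) = A k + ?p * \<delta> k"
        using True by (simp add: A_def lessThan_Suc Int_insert_right)
      ultimately show ?thesis
        using Suc.IH A_le[of k] A_le[of "Suc k"] True by (simp add: field_simps)
    qed (use Suc.IH in \<open>simp add: A_def lessThan_Suc Int_insert_right\<close>)
  qed (simp add: A_def)
  obtain k where "T \<subseteq> {..<k}"
    using assms(1) by (auto simp: finite_nat_set_iff_bounded)
  then have "T \<inter> {..<k} = T"
    by auto
  moreover have "(1 - A k) / 2 ^ Suc (branchings_below T k) \<ge> 0"
    using A_le[of k] by simp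
  ultimately show ?thesis
    using partial[of k] by simp
qed

theorem theorem7p3:
  fixes d :: nat and U :: "bool list set" and H :: "bool list set set" and \<eta> :: real
  assumes "d \<ge> 1"
    and "U \<subseteq> binary_interval d"
    and "simple_graph_on U H"
    and "ordered_triangle_free H"
    and "\<eta> > 0"
  shows "real (card {l \<in> {1..d}.
           real (edges_at_level H l) \<ge> 1 / 2 * real (UU U l) + \<eta> * real (tau l d)})
         \<le> 1 / (2 * \<eta>)"
proof -
  define S where "S = {l \<in> {1..d}.
    real (edges_at_level H l) \<ge> 1 / 2 * real (UU U l) + \<eta> * real (tau l d)}"
  define \<delta> where "\<delta> h = (real (edges_at_level H (d - h)) - 1/2 * real (UU U (d - h)))
    / real (tau (d - h) d)" for h
  define T where "T = (\<lambda>l. d - l) ` S"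
  have "finite S" and S: "S \<subseteq> {1..d}"
    by (auto simp: S_def)
  then have finT: "finite T" and T: "T \<subseteq> {..<d}"
    by (auto simp: T_def)
  have "inj_on (\<lambda>l. d - l) S"
    using S by (intro inj_onI) (metis atLeastAtMost_iff diff_diff_cancel subsetD)
  then have card: "card T = card S"
    by (simp add: T_def card_image)
  have large: "\<eta> \<le> \<delta> h" if "h \<in> T" for h
  proof -
    obtain l where l: "l \<in> S" "h = d - l"
      using \<open>h \<in> T\<close> by (auto simp: T_def)
    with S have "d - h = l" "real (tau l d) > 0"
      by (auto simp: tau_eq)
    with l show ?thesis
      by (simp add: \<delta>_def S_def field_simps)
  qed
  have "(\<Sum>h\<in>T. \<delta> h) \<le> 1 / 2"
  proof (rule sum_le_half_of_weighted[OF finT])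
    fix k
    \<comment> \<open>Truncating \<open>T\<close> from above leaves the weights of the remaining heights unchanged, so all
      partial sums are bounded by the excess inequality for a smaller set of heights.\<close>
    have "branchings_below (T \<inter> {..<k}) h = branchings_below T h" if "h < k" for h
      using that by (auto simp: branchings_below_def intro!: arg_cong[of _ _ card])
    moreover have "T \<inter> {..<k} \<subseteq> {..<d}"
      using T by auto
    ultimately show "(\<Sum>h\<in>T \<inter> {..<k}. 2 ^ Suc (branchings_below T h) * \<delta> h) \<le> 1"
      using weighted_excess_le_one[OF assms(2-4), of "T \<inter> {..<k}"] by (simp add: \<delta>_def)
  qed
  moreover have "real (card S) * \<eta> \<le> (\<Sum>h\<in>T. \<delta> h)"
    using sum_mono[of T "\<lambda>_. \<eta>" \<delta>] large card by simp
  ultimately have "real (card S) * \<eta> \<le> 1 / 2"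
    by linarith
  with \<open>\<eta> > 0\<close> show ?thesis
    unfolding S_def by (simp add: field_simps)
qed

end
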